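(* Let $k$ be a positive integer, let $a_j,b_j\in(0,\infty)$ for $j=0,\ldots,k$, and let $a(x)=a_0\prod_{j=1}^k(x+a_j)$, $b(x)=b_0\prod_{j=1}^k(x+b_j)$, $x\in\mathbb{R}_+$. Let $\{c(m)\}_{m\in\mathbb{Z}_+}$ be a sequence of positive real numbers. Assume that (A1) $b_1\le a_1\le b_2\le a_2\le\cdots\le b_k\le a_k$, (A2) $\big\{\frac{c(m)}{a(m)}\big\}_{m\in\mathbb{Z}_+}$ is a completely monotone sequence. Then: (a) the net $\big\{\frac{c(m)}{b(m)+a(m)n}\big\}_{m,n\in\mathbb{Z}_+}$ is joint completely monotone; (b) $\big\{\frac{c(m)}{b(m)+a(m)n}\big\}_{m,n\in\mathbb{Z}_+}$ is a minimal joint completely monotone net provided $\big\{\frac{c(m)}{a(m)}\big\}_{m\in\mathbb{Z}_+}$ is a minimal completely monotone sequence.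
   Context: $\mathbb{Z}_+$ is the set of nonnegative integers and $\mathbb{R}_+$ the set of nonnegative reals. For a real sequence $\{u_k\}_{k\in\mathbb{Z}_+}$ put $\triangle u_k=u_{k+1}-u_k$; the sequence is completely monotone if $(-1)^j\triangle^j u_k\ge 0$ for all $j,k\in\mathbb{Z}_+$, and a completely monotone sequence is minimal if for every $\epsilon>0$ the sequence $\{u_k-\epsilon\mathbf{1}_{\{0\}}(k)\}_k$ is not completely monotone. For a real net $\{u_{m,n}\}_{m,n\in\mathbb{Z}_+}$ put $\triangle_1u_{m,n}=u_{m+1,n}-u_{m,n}$ and $\triangle_2u_{m,n}=u_{m,n+1}-u_{m,n}$. The net is joint completely monotone if $(-1)^{i+j}\triangle_1^i\triangle_2^j u_{m,n}\ge 0$ for all $i,j,m,n\in\mathbb{Z}_+$. A joint completely monotone net is minimal if for every $\epsilon>0$ neither of the sequences $\{u_{k,0}-\epsilon\mathbf{1}_{\{0\}}(k)\}_k$ and $\{u_{0,k}-\epsilon\mathbf{1}_{\{0\}}(k)\}_k$ is completely monotone, where $\mathbf{1}_{\{0\}}$ is the indicator function of $\{0\}$. *)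

theory Defs
  imports Complex_Main
begin

definition fwd_diff :: "(nat \<Rightarrow> real) \<Rightarrow> nat \<Rightarrow> real" where
  "fwd_diff u = (\<lambda>k. u (k + 1) - u k)"

definition completely_monotone :: "(nat \<Rightarrow> real) \<Rightarrow> bool" where
  "completely_monotone u \<longleftrightarrow> (\<forall>j k. (-1) ^ j * (fwd_diff ^^ j) u k \<ge> 0)"

definition minimal_completely_monotone :: "(nat \<Rightarrow> real) \<Rightarrow> bool" where
  "minimal_completely_monotone u \<longleftrightarrow>
     completely_monotone u \<and>
     (\<forall>\<epsilon>>0. \<not> completely_monotone (\<lambda>k. u k - \<epsilon> * of_bool (k = 0)))"

definition fwd_diff1 :: "(nat \<Rightarrow> nat \<Rightarrow> real) \<Rightarrow> nat \<Rightarrow> nat \<Rightarrow> real" where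
  "fwd_diff1 u = (\<lambda>m n. u (m + 1) n - u m n)"

definition fwd_diff2 :: "(nat \<Rightarrow> nat \<Rightarrow> real) \<Rightarrow> nat \<Rightarrow> nat \<Rightarrow> real" where
  "fwd_diff2 u = (\<lambda>m n. u m (n + 1) - u m n)"

definition joint_completely_monotone :: "(nat \<Rightarrow> nat \<Rightarrow> real) \<Rightarrow> bool" where
  "joint_completely_monotone u \<longleftrightarrow>
     (\<forall>i j m n. (-1) ^ (i + j) * (fwd_diff1 ^^ i) ((fwd_diff2 ^^ j) u) m n \<ge> 0)"

definition minimal_joint_completely_monotone :: "(nat \<Rightarrow> nat \<Rightarrow> real) \<Rightarrow> bool" where
  "minimal_joint_completely_monotone u \<longleftrightarrow>
     joint_completely_monotone u \<and>
     (\<forall>\<epsilon>>0. \<not> completely_monotone (\<lambda>k. u k 0 - \<epsilon> * of_bool (k = 0)) \<and>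
             \<not> completely_monotone (\<lambda>k. u 0 k - \<epsilon> * of_bool (k = 0)))"

text \<open>The coefficient \<open>r 0\<close> is the leading coefficient; the roots are \<open>- r 1, \<dots>, - r k\<close>.\<close>

definition root_poly :: "nat \<Rightarrow> (nat \<Rightarrow> real) \<Rightarrow> real \<Rightarrow> real" where
  "root_poly k r x = r 0 * (\<Prod>j=1..k. (x + r j))"

end

theory Submission
  imports Defs
begin

text \<open>
  Write \<open>D = - \<triangle>\<close> and \<open>q = b / a\<close>, so that the net is \<open>(c / a)(m) / (q(m) + n)\<close>. Iterated
  differences in \<open>n\<close> turn this into constant multiples of products of \<open>c / a\<close> with factors
  \<open>1 / (q(m) + t)\<close>, \<open>t \<ge> 0\<close>. Interlacing makes \<open>q\<close> a positive constant minus a nonnegative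
  combination of the functions \<open>1 / (x + a\<^sub>j)\<close>, so \<open>\<triangle> q\<close> is completely monotone; as
  \<open>D (1 / Q) (m) = \<triangle> Q (m) \<cdot> (1 / Q (m)) \<cdot> (1 / Q (m + 1))\<close>, induction on the order shows that
  \<open>1 / (q + t)\<close> is completely monotone, and complete monotonicity is preserved by products.

  A completely monotone sequence \<open>u\<close> is minimal iff \<open>(D\<^sup>j u) 0\<close>, which is decreasing in \<open>j\<close>,
  tends to \<open>0\<close> (the limit is the mass at \<open>0\<close> of the representing measure). Minimality is preserved
  by products, and the identity for \<open>D (1 / Q)\<close> shows that \<open>1 / Q\<close> is minimal if \<open>\<triangle> Q\<close> is: the
  limit \<open>L\<close> for \<open>1 / Q\<close> satisfies \<open>L \<le> (1 - Q 0 / Q 1) L\<close>.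
\<close>

section \<open>Signed differences and closure properties of complete monotonicity\<close>

definition mdiff :: "(nat \<Rightarrow> real) \<Rightarrow> nat \<Rightarrow> real" where
  "mdiff f = (\<lambda>m. f m - f (Suc m))"

lemma fwd_diff_funpow: "(-1) ^ j * (fwd_diff ^^ j) f k = (mdiff ^^ j) f k"
proof (induction j arbitrary: k)
  case (Suc j)
  have "(-1) ^ Suc j * (fwd_diff ^^ Suc j) f k
      = (-1) ^ j * (fwd_diff ^^ j) f k - (-1) ^ j * (fwd_diff ^^ j) f (Suc k)"
    by (simp add: fwd_diff_def algebra_simps)
  then show ?case by (simp add: Suc mdiff_def)
qed simp

lemma completely_monotone_iff: "completely_monotone f \<longleftrightarrow> (\<forall>j k. (mdiff ^^ j) f k \<ge> 0)"
  by (simp add: completely_monotone_def fwd_diff_funpow)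

lemma mdiff_funpow_add: "(mdiff ^^ j) (\<lambda>m. f m + g m) k = (mdiff ^^ j) f k + (mdiff ^^ j) g k"
  by (induction j arbitrary: k) (auto simp: mdiff_def)

lemma mdiff_funpow_cmult: "(mdiff ^^ j) (\<lambda>m. r * f m) k = r * (mdiff ^^ j) f k"
  by (induction j arbitrary: k) (auto simp: mdiff_def algebra_simps)

lemma mdiff_funpow_shift: "(mdiff ^^ j) (\<lambda>m. f (Suc m)) k = (mdiff ^^ j) f (Suc k)"
  by (induction j arbitrary: k) (auto simp: mdiff_def)

lemma mdiff_funpow_Suc: "(mdiff ^^ Suc j) f k = (mdiff ^^ j) f k - (mdiff ^^ j) f (Suc k)"
  by (simp add: mdiff_def)

lemma mdiff_funpow_mdiff: "(mdiff ^^ j) (mdiff f) = (mdiff ^^ Suc j) f"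
  by (simp add: funpow_swap1)

lemma mdiff_funpow_zero: "(mdiff ^^ j) (\<lambda>m. 0) k = 0"
  by (induction j arbitrary: k) (auto simp: mdiff_def)

text \<open>The identity for \<open>D (1 / Q)\<close> contains \<open>1 / Q\<close> again, so
  complete monotonicity cannot be read off from it at once. Bounding the order of differences gives
  something to induct on.\<close>

fun cm_upto :: "nat \<Rightarrow> (nat \<Rightarrow> real) \<Rightarrow> bool" where
  "cm_upto 0 f \<longleftrightarrow> (\<forall>k. f k \<ge> 0)"
| "cm_upto (Suc N) f \<longleftrightarrow> (\<forall>k. f k \<ge> 0) \<and> cm_upto N (mdiff f)"

lemma cm_upto_iff: "cm_upto N f \<longleftrightarrow> (\<forall>j\<le>N. \<forall>k. (mdiff ^^ j) f k \<ge> 0)"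
proof (induction N arbitrary: f)
  case (Suc N)
  have "(\<forall>j\<le>Suc N. P j) \<longleftrightarrow> P 0 \<and> (\<forall>j\<le>N. P (Suc j))" for P
    by (metis Suc_le_mono le0 nat.exhaust)
  then show ?case by (simp add: Suc.IH mdiff_funpow_mdiff del: funpow.simps(2))
qed simp

lemma completely_monotone_iff_upto: "completely_monotone f \<longleftrightarrow> (\<forall>N. cm_upto N f)"
  unfolding completely_monotone_iff cm_upto_iff by blast

lemma cm_upto_nonneg: "cm_upto N f \<Longrightarrow> f k \<ge> 0"
  by (cases N) auto

lemma cm_upto_Suc: "cm_upto (Suc N) f \<Longrightarrow> cm_upto N f"
  by (simp only: cm_upto_iff) auto

lemma cm_upto_add: "cm_upto N f \<Longrightarrow> cm_upto N g \<Longrightarrow> cm_upto N (\<lambda>m. f m + g m)"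
  by (simp add: cm_upto_iff mdiff_funpow_add)

lemma cm_upto_shift: "cm_upto N f \<Longrightarrow> cm_upto N (\<lambda>m. f (Suc m))"
  by (simp add: cm_upto_iff mdiff_funpow_shift)

text \<open>Leibniz rule: \<open>D (f g)\<close> is \<open>D f\<close> times \<open>g\<close> plus
  the shift of \<open>f\<close> times \<open>D g\<close>. Each factor there has order
  \<open>N\<close>, so the induction hypothesis applies to both products.\<close>

lemma cm_upto_mult: "cm_upto N f \<Longrightarrow> cm_upto N g \<Longrightarrow> cm_upto N (\<lambda>m. f m * g m)"
proof (induction N arbitrary: f g)
  case (Suc N)
  have leibniz: "mdiff (\<lambda>m. f m * g m) = (\<lambda>m. mdiff f m * g m + f (Suc m) * mdiff g m)"
    by (auto simp: mdiff_def algebra_simps)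
  have "cm_upto N (\<lambda>m. mdiff f m * g m + f (Suc m) * mdiff g m)"
    by (intro cm_upto_add Suc.IH cm_upto_shift) (use Suc.prems cm_upto_Suc in auto)
  then show ?case using Suc.prems leibniz by simp
qed simp

lemma completely_monotone_nonneg: "completely_monotone f \<Longrightarrow> f k \<ge> 0"
  by (auto simp: completely_monotone_iff_upto dest: cm_upto_nonneg)

lemma completely_monotone_mult:
  "completely_monotone f \<Longrightarrow> completely_monotone g \<Longrightarrow> completely_monotone (\<lambda>m. f m * g m)"
  by (simp add: completely_monotone_iff_upto cm_upto_mult)

lemma completely_monotone_add:
  "completely_monotone f \<Longrightarrow> completely_monotone g \<Longrightarrow> completely_monotone (\<lambda>m. f m + g m)"
  by (simp add: completely_monotone_iff mdiff_funpow_add)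

lemma completely_monotone_cmult:
  "r \<ge> 0 \<Longrightarrow> completely_monotone f \<Longrightarrow> completely_monotone (\<lambda>m. r * f m)"
  by (simp add: completely_monotone_iff mdiff_funpow_cmult)

lemma completely_monotone_shift:
  "completely_monotone f \<Longrightarrow> completely_monotone (\<lambda>m. f (Suc m))"
  by (simp add: completely_monotone_iff mdiff_funpow_shift)

lemma completely_monotone_mdiff_funpow:
  "completely_monotone f \<Longrightarrow> completely_monotone ((mdiff ^^ i) f)"
  by (simp add: completely_monotone_iff flip: funpow_add o_apply[of "mdiff ^^ _"])

lemma completely_monotone_mdiff: "completely_monotone f \<Longrightarrow> completely_monotone (mdiff f)"
  using completely_monotone_mdiff_funpow[of f 1] by simp

lemma completely_monotone_zero: "completely_monotone (\<lambda>m. 0)"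
  by (simp add: completely_monotone_iff mdiff_funpow_zero)

lemma completely_monotone_sum:
  "(\<And>i. i \<in> I \<Longrightarrow> completely_monotone (f i)) \<Longrightarrow> completely_monotone (\<lambda>m. \<Sum>i\<in>I. f i m)"
  by (induction I rule: infinite_finite_induct)
     (auto intro: completely_monotone_add completely_monotone_zero)

lemma completely_monotone_const: "r \<ge> 0 \<Longrightarrow> completely_monotone (\<lambda>m. r)"
proof -
  assume r: "r \<ge> 0"
  have "mdiff (\<lambda>m. r) = (\<lambda>m. 0)" by (simp add: mdiff_def)
  then have "(mdiff ^^ j) (\<lambda>m. r) k \<ge> 0" for j k
    using r by (cases j) (simp_all add: mdiff_funpow_zero flip: mdiff_funpow_mdiff del: funpow.simps(2))
  then show ?thesis by (simp add: completely_monotone_iff)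
qed

lemma completely_monotone_prod:
  "(\<And>i. i \<in> I \<Longrightarrow> completely_monotone (f i)) \<Longrightarrow> completely_monotone (\<lambda>m. \<Prod>i\<in>I. f i m)"
  by (induction I rule: infinite_finite_induct)
     (auto intro: completely_monotone_mult completely_monotone_const)

lemma mdiff_inverse:
  assumes "\<And>m. Q m > 0"
  shows "mdiff (\<lambda>m. 1 / Q m) = (\<lambda>m. ((Q (Suc m) - Q m) * (1 / Q (Suc m))) * (1 / Q m))"
proof
  fix m show "mdiff (\<lambda>m. 1 / Q m) m = ((Q (Suc m) - Q m) * (1 / Q (Suc m))) * (1 / Q m)"
    using assms[of m] assms[of "Suc m"] by (simp add: mdiff_def field_simps)
qed

text \<open>In \<open>mdiff_inverse\<close> the increments of \<open>Q\<close> are multiplied by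
  \<open>1 / Q\<close> and its shift. Order \<open>N\<close> for \<open>1 / Q\<close> thus gives
  order \<open>N\<close> for \<open>D (1 / Q)\<close>, which is order \<open>N + 1\<close> for
  \<open>1 / Q\<close>.\<close>

lemma completely_monotone_inverse:
  assumes pos: "\<And>m. Q m > 0" and cm: "completely_monotone (\<lambda>m. Q (Suc m) - Q m)"
  shows "completely_monotone (\<lambda>m. 1 / Q m)"
proof -
  have nonneg: "1 / Q m \<ge> 0" for m
    using pos[of m] by simp
  have "cm_upto N (\<lambda>m. 1 / Q m)" for N
  proof (induction N)
    case (Suc N)
    have "cm_upto N (mdiff (\<lambda>m. 1 / Q m))"
      unfolding mdiff_inverse[of Q, OF pos]
      using cm by (intro cm_upto_mult cm_upto_shift[OF Suc] Suc) (simp add: completely_monotone_iff_upto)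
    then show ?case using nonneg by simp
  qed (use nonneg in simp)
  then show ?thesis by (simp add: completely_monotone_iff_upto)
qed

section \<open>Minimality as a vanishing limit of differences at 0\<close>

lemma completely_monotone_decseq:
  assumes "completely_monotone f"
  shows "decseq (\<lambda>j. (mdiff ^^ j) f k)"
proof (rule decseq_SucI)
  fix j show "(mdiff ^^ Suc j) f k \<le> (mdiff ^^ j) f k"
    using assms mdiff_funpow_Suc[of j f k] by (simp add: completely_monotone_iff)
qed

lemma completely_monotone_convergent:
  assumes "completely_monotone f"
  shows "convergent (\<lambda>j. (mdiff ^^ j) f k)"
proof -
  have "\<And>j. (mdiff ^^ j) f k \<ge> 0" using assms by (simp add: completely_monotone_iff)
  then obtain L where "(\<lambda>j. (mdiff ^^ j) f k) \<longlonglongrightarrow> L"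
    using decseq_convergent[OF completely_monotone_decseq[OF assms]] by metis
  then show ?thesis by (auto simp: convergent_def)
qed

lemma mdiff_funpow_le:
  "completely_monotone f \<Longrightarrow> (mdiff ^^ j) f k \<le> f k"
  using decseqD[OF completely_monotone_decseq[of f k], of 0 j] by simp

text \<open>Differences at \<open>k\<close> only look at indices from \<open>k\<close> on, and index
  0 enters a difference at 0 with coefficient 1 at every order.\<close>

lemma mdiff_funpow_indicator:
  "(mdiff ^^ j) (\<lambda>k. f k - \<epsilon> * of_bool (k = 0)) k = (mdiff ^^ j) f k - \<epsilon> * of_bool (k = 0)"
  by (induction j arbitrary: k) (auto simp: mdiff_def)

text \<open>Subtracting \<open>\<epsilon>\<close> at 0 lowers every \<open>(D\<^sup>j f) 0\<close>
  by exactly \<open>\<epsilon>\<close> and changes no difference at a positive index. The admissible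
  \<open>\<epsilon>\<close> are therefore those with \<open>\<epsilon> \<le> L\<close>, where
  \<open>L\<close> is the limit of the decreasing sequence.\<close>

lemma minimal_completely_monotone_iff:
  "minimal_completely_monotone f \<longleftrightarrow>
     completely_monotone f \<and> (\<lambda>j. (mdiff ^^ j) f 0) \<longlonglongrightarrow> 0"
proof (cases "completely_monotone f")
  case True
  then obtain L where L: "(\<lambda>j. (mdiff ^^ j) f 0) \<longlonglongrightarrow> L"
    using completely_monotone_convergent by (auto simp: convergent_def)
  have ge: "(mdiff ^^ j) f 0 \<ge> L" for j
    using decseq_ge[OF completely_monotone_decseq[OF True] L] .
  have nonneg: "L \<ge> 0"
    using True by (intro LIMSEQ_le_const[OF L]) (auto simp: completely_monotone_iff)
  have cm: "completely_monotone (\<lambda>k. f k - \<epsilon> * of_bool (k = 0)) \<longleftrightarrow> \<epsilon> \<le> L" for \<epsilon>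
  proof
    assume "completely_monotone (\<lambda>k. f k - \<epsilon> * of_bool (k = 0))"
    then have "(mdiff ^^ j) f 0 - \<epsilon> * of_bool ((0::nat) = 0) \<ge> 0" for j
      unfolding completely_monotone_iff mdiff_funpow_indicator by blast
    then have "\<epsilon> \<le> (mdiff ^^ j) f 0" for j by (simp add: algebra_simps)
    then show "\<epsilon> \<le> L" by (intro LIMSEQ_le_const[OF L]) auto
  next
    assume le: "\<epsilon> \<le> L"
    have "(mdiff ^^ j) f k - \<epsilon> * of_bool (k = 0) \<ge> 0" for j k
      using True order_trans[OF le ge[of j]] by (cases k) (auto simp: completely_monotone_iff)
    then show "completely_monotone (\<lambda>k. f k - \<epsilon> * of_bool (k = 0))"
      unfolding completely_monotone_iff mdiff_funpow_indicator by blast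
  qed
  have "minimal_completely_monotone f \<longleftrightarrow> L = 0"
    unfolding minimal_completely_monotone_def cm using True nonneg by force
  moreover have "(\<lambda>j. (mdiff ^^ j) f 0) \<longlonglongrightarrow> 0 \<longleftrightarrow> L = 0"
    using L LIMSEQ_unique by blast
  ultimately show ?thesis using True by simp
qed (simp add: minimal_completely_monotone_def)

text \<open>The difference of order \<open>j\<close> at 1 is the gap between the consecutive terms
  \<open>j\<close> and \<open>j + 1\<close> of a convergent sequence.\<close>

lemma shift_tendsto_0:
  assumes "completely_monotone f"
  shows "(\<lambda>j. (mdiff ^^ j) (\<lambda>m. f (Suc m)) 0) \<longlonglongrightarrow> 0"
proof -
  obtain L where L: "(\<lambda>j. (mdiff ^^ j) f 0) \<longlonglongrightarrow> L"
    using completely_monotone_convergent[OF assms] by (auto simp: convergent_def)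
  have "(\<lambda>j. (mdiff ^^ j) f 0 - (mdiff ^^ Suc j) f 0) \<longlonglongrightarrow> L - L"
    by (intro tendsto_diff L LIMSEQ_Suc[OF L])
  then show ?thesis unfolding mdiff_funpow_shift mdiff_funpow_Suc by simp
qed

lemma minimal_shift:
  "completely_monotone f \<Longrightarrow> minimal_completely_monotone (\<lambda>m. f (Suc m))"
  by (simp add: minimal_completely_monotone_iff completely_monotone_shift shift_tendsto_0)

text \<open>Telescoping: each summand is \<open>(D\<^sup>l f) m\<close> minus the same expression
  with \<open>l + 1\<close>.\<close>

lemma split_shift:
  "f m = (\<Sum>l<J. (mdiff ^^ l) f (Suc m)) + (mdiff ^^ J) f m"
  by (induction J) (auto simp: mdiff_def)

text \<open>
  Write \<open>f\<close> and \<open>g\<close> as shifted completely monotone sequences plus \<open>D\<^sup>J f\<close> and \<open>D\<^sup>J g\<close>: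
  the product of the two shifts is a shift and contributes nothing to the limit.
\<close>

lemma mult_limit_le:
  assumes f: "completely_monotone f" and g: "completely_monotone g"
    and L: "(\<lambda>j. (mdiff ^^ j) (\<lambda>m. f m * g m) 0) \<longlonglongrightarrow> L"
  shows "L \<le> f 0 * (mdiff ^^ J) g 0 + (mdiff ^^ J) f 0 * g 0"
proof -
  define p where "p = (\<lambda>m. \<Sum>l<J. (mdiff ^^ l) f m)"
  define r where "r = (\<lambda>m. \<Sum>l<J. (mdiff ^^ l) g m)"
  define F where "F = (mdiff ^^ J) f"
  define G where "G = (mdiff ^^ J) g"
  have cm: "completely_monotone p" "completely_monotone r" "completely_monotone F" "completely_monotone G"
    unfolding p_def r_def F_def G_def
    by (intro completely_monotone_sum completely_monotone_mdiff_funpow f g)+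
  have f_eq: "f m = p (Suc m) + F m" for m
    unfolding p_def F_def by (rule split_shift)
  have g_eq: "g m = r (Suc m) + G m" for m
    unfolding r_def G_def by (rule split_shift)
  have fg: "(\<lambda>m. f m * g m) = (\<lambda>m. p (Suc m) * r (Suc m) + (p (Suc m) * G m + F m * g m))"
    by (auto simp: f_eq g_eq algebra_simps)
  \<comment> \<open>The two mixed products are completely monotone, so their differences at 0 never
    exceed their values there. This bounds them uniformly in \<open>j\<close>, while the pure shift
    is left to tend to 0.\<close>
  have "(mdiff ^^ j) (\<lambda>m. f m * g m) 0
      \<le> (mdiff ^^ j) (\<lambda>m. p (Suc m) * r (Suc m)) 0 + (f 0 * G 0 + F 0 * g 0)" for j
  proof -
    have "(mdiff ^^ j) (\<lambda>m. p (Suc m) * G m) 0 \<le> p (Suc 0) * G 0"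
      by (intro mdiff_funpow_le[of "\<lambda>m. p (Suc m) * G m"] completely_monotone_mult
          completely_monotone_shift cm)
    also have "\<dots> \<le> f 0 * G 0"
      using cm f_eq[of 0] by (intro mult_right_mono) (auto simp: completely_monotone_nonneg)
    finally have "(mdiff ^^ j) (\<lambda>m. p (Suc m) * G m) 0 \<le> f 0 * G 0" .
    moreover have "(mdiff ^^ j) (\<lambda>m. F m * g m) 0 \<le> F 0 * g 0"
      by (intro mdiff_funpow_le[of "\<lambda>m. F m * g m"] completely_monotone_mult cm g)
    ultimately show ?thesis unfolding fg mdiff_funpow_add by linarith
  qed
  moreover have "(\<lambda>j. (mdiff ^^ j) (\<lambda>m. p (Suc m) * r (Suc m)) 0 + (f 0 * G 0 + F 0 * g 0))
      \<longlonglongrightarrow> 0 + (f 0 * G 0 + F 0 * g 0)"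
    by (intro tendsto_intros shift_tendsto_0[of "\<lambda>m. p m * r m"] completely_monotone_mult cm)
  ultimately have "L \<le> 0 + (f 0 * G 0 + F 0 * g 0)"
    using L LIMSEQ_le by blast
  then show ?thesis by (simp add: F_def G_def)
qed

lemma minimal_mult:
  assumes "minimal_completely_monotone f" "minimal_completely_monotone g"
  shows "minimal_completely_monotone (\<lambda>m. f m * g m)"
proof -
  have f: "completely_monotone f" "(\<lambda>j. (mdiff ^^ j) f 0) \<longlonglongrightarrow> 0"
   and g: "completely_monotone g" "(\<lambda>j. (mdiff ^^ j) g 0) \<longlonglongrightarrow> 0"
    using assms by (auto simp: minimal_completely_monotone_iff)
  have fg: "completely_monotone (\<lambda>m. f m * g m)"
    using f g by (intro completely_monotone_mult)
  then obtain L where L: "(\<lambda>j. (mdiff ^^ j) (\<lambda>m. f m * g m) 0) \<longlonglongrightarrow> L"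
    using completely_monotone_convergent[OF fg] by (auto simp: convergent_def)
  have "(\<lambda>J. f 0 * (mdiff ^^ J) g 0 + (mdiff ^^ J) f 0 * g 0) \<longlonglongrightarrow> f 0 * 0 + 0 * g 0"
    by (intro tendsto_intros f g)
  then have "L \<le> f 0 * 0 + 0 * g 0"
    using mult_limit_le[OF f(1) g(1) L] by (intro LIMSEQ_le_const) auto
  moreover have "L \<ge> 0"
    using fg by (intro LIMSEQ_le_const[OF L]) (auto simp: completely_monotone_iff)
  ultimately have "L = 0" by simp
  then show ?thesis using L fg by (simp add: minimal_completely_monotone_iff)
qed

lemma minimal_add:
  assumes "minimal_completely_monotone f" "minimal_completely_monotone g"
  shows "minimal_completely_monotone (\<lambda>m. f m + g m)"
  using assms tendsto_add[of _ 0 _ _ 0]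
  by (auto simp: minimal_completely_monotone_iff completely_monotone_add mdiff_funpow_add)

lemma minimal_cmult:
  assumes "r \<ge> 0" "minimal_completely_monotone f"
  shows "minimal_completely_monotone (\<lambda>m. r * f m)"
  using assms tendsto_mult_right_zero[of _ _ r]
  by (auto simp: minimal_completely_monotone_iff completely_monotone_cmult mdiff_funpow_cmult)

lemma minimal_mdiff:
  assumes "minimal_completely_monotone f"
  shows "minimal_completely_monotone (mdiff f)"
  using assms LIMSEQ_Suc[of "\<lambda>j. (mdiff ^^ j) f 0" 0]
  by (simp add: minimal_completely_monotone_iff completely_monotone_mdiff mdiff_funpow_mdiff
      del: funpow.simps(2))

text \<open>A constant sequence is its own shift.\<close>

lemma minimal_const:
  assumes "r \<ge> 0"
  shows "minimal_completely_monotone (\<lambda>m. r)"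
  using minimal_shift[OF completely_monotone_const[OF assms]] .

lemma minimal_sum:
  "(\<And>i. i \<in> I \<Longrightarrow> minimal_completely_monotone (f i)) \<Longrightarrow>
     minimal_completely_monotone (\<lambda>m. \<Sum>i\<in>I. f i m)"
  by (induction I rule: infinite_finite_induct) (auto intro: minimal_add minimal_const)

lemma minimal_inverse:
  assumes pos: "\<And>m. Q m > 0" and min: "minimal_completely_monotone (\<lambda>m. Q (Suc m) - Q m)"
  shows "minimal_completely_monotone (\<lambda>m. 1 / Q m)"
proof -
  define v where "v = (\<lambda>m. 1 / Q m)"
  define s where "s = (\<lambda>m. (Q (Suc m) - Q m) * v (Suc m))"
  have v: "completely_monotone v"
    unfolding v_def
    using min by (intro completely_monotone_inverse pos) (simp add: minimal_completely_monotone_def)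
  have s: "minimal_completely_monotone s"
    unfolding s_def by (intro minimal_mult min minimal_shift v)
  have vs: "mdiff v = (\<lambda>m. s m * v m)"
    using mdiff_inverse[of Q, OF pos] by (simp add: v_def s_def)
  obtain L where L: "(\<lambda>j. (mdiff ^^ j) v 0) \<longlonglongrightarrow> L"
    using completely_monotone_convergent[OF v] by (auto simp: convergent_def)
  \<comment> \<open>Since \<open>s v = D v\<close>, this is the defining sequence of
    \<open>L\<close> started one order later. The product bound then has \<open>L\<close> on both
    sides once \<open>J\<close> tends to infinity.\<close>
  have "(\<lambda>j. (mdiff ^^ j) (\<lambda>m. s m * v m) 0) \<longlonglongrightarrow> L"
    unfolding vs[symmetric] mdiff_funpow_mdiff by (rule LIMSEQ_Suc[OF L])
  then have le: "L \<le> s 0 * (mdiff ^^ J) v 0 + (mdiff ^^ J) s 0 * v 0" for J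
    using s v by (intro mult_limit_le) (auto simp: minimal_completely_monotone_def)
  have "(\<lambda>J. s 0 * (mdiff ^^ J) v 0 + (mdiff ^^ J) s 0 * v 0) \<longlonglongrightarrow> s 0 * L + 0 * v 0"
    using s by (intro tendsto_intros L) (auto simp: minimal_completely_monotone_iff)
  then have "L \<le> s 0 * L + 0 * v 0"
    using le by (intro LIMSEQ_le_const) auto
  then have "(1 - s 0) * L \<le> 0" by (simp add: algebra_simps)
  \<comment> \<open>Here \<open>1 - s 0 = Q 0 / Q 1\<close>.\<close>
  moreover have "1 - s 0 > 0"
    using pos[of 0] pos[of 1] by (simp add: s_def v_def field_simps)
  ultimately have "L \<le> 0" by (simp add: mult_le_0_iff)
  moreover have "L \<ge> 0"
    using v by (intro LIMSEQ_le_const[OF L]) (auto simp: completely_monotone_iff)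
  ultimately show ?thesis
    using L v by (simp add: minimal_completely_monotone_iff flip: v_def)
qed

lemma minimal_inverse_linear:
  assumes "r > 0"
  shows "minimal_completely_monotone (\<lambda>m. 1 / (r + real m))"
  by (rule minimal_inverse) (use assms in \<open>auto simp: minimal_const add_pos_nonneg\<close>)

section \<open>Partial fractions of the interlacing quotient\<close>

text \<open>Induction on the number of factors. Multiplying by \<open>(x + B) / (x + A)\<close>
  moves a share \<open>s j\<close> of each old weight \<open>r j\<close> to the new pole
  \<open>- A\<close>. Since \<open>a j \<le> B \<le> A\<close>, this share lies between 0 and
  \<open>r j\<close>, so all weights stay nonnegative.\<close>

lemma interlacing_partial_fractions:
  fixes a b :: "nat \<Rightarrow> real"
  assumes "\<And>j. 1 \<le> j \<Longrightarrow> j \<le> k \<Longrightarrow> a j > 0"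
    and "\<And>j. 1 \<le> j \<Longrightarrow> j \<le> k \<Longrightarrow> b j \<le> a j"
    and "\<And>i j. 1 \<le> i \<Longrightarrow> i < j \<Longrightarrow> j \<le> k \<Longrightarrow> a i \<le> b j"
  shows "\<exists>r. (\<forall>j. r j \<ge> 0) \<and>
           (\<forall>x\<ge>0. (\<Prod>j=1..k. (x + b j) / (x + a j)) = 1 - (\<Sum>j=1..k. r j / (x + a j)))"
  using assms
proof (induction k)
  case (Suc k)
  obtain r where r: "\<And>j. r j \<ge> 0"
    and eq: "\<And>x. x \<ge> 0 \<Longrightarrow> (\<Prod>j=1..k. (x + b j) / (x + a j)) = 1 - (\<Sum>j=1..k. r j / (x + a j))"
    using Suc.IH Suc.prems by force
  define A where "A = a (Suc k)"
  define B where "B = b (Suc k)"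
  have AB: "B \<le> A" "A > 0"
    using Suc.prems(1)[of "Suc k"] Suc.prems(2)[of "Suc k"] by (auto simp: A_def B_def)
  have aB: "a j > 0" "a j \<le> B" if "j \<in> {1..k}" for j
    using that Suc.prems(1)[of j] Suc.prems(3)[of j "Suc k"] by (auto simp: B_def)
  text \<open>If \<open>a j = A\<close> then \<open>B = A\<close>, so the weight \<open>s j = r j * (0 / 0) = 0\<close> below is harmless.\<close>
  define s where "s j = r j * ((A - B) / (A - a j))" for j
  \<comment> \<open>The new pole receives \<open>A - B\<close> from the new factor itself and all
    the moved shares. The value 0 off the range makes nonnegativity hold for every index.\<close>
  define r' where "r' j = (if j = Suc k then (A - B) + (\<Sum>i=1..k. s i) else
                           if j \<in> {1..k} then r j - s j else 0)" for j
  have s: "0 \<le> s j" "s j \<le> r j" if "j \<in> {1..k}" for j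
  proof -
    have *: "0 \<le> (A - B) / (A - a j)" "(A - B) / (A - a j) \<le> 1"
      using AB aB[OF that] by (auto simp: divide_simps)
    show "0 \<le> s j" unfolding s_def by (rule mult_nonneg_nonneg[OF r *(1)])
    show "s j \<le> r j" unfolding s_def by (rule mult_left_le[OF *(2) r])
  qed
  have "r' j \<ge> 0" for j
    using s AB by (auto simp: r'_def intro!: add_nonneg_nonneg sum_nonneg)
  moreover have "(\<Prod>j=1..Suc k. (x + b j) / (x + a j)) = 1 - (\<Sum>j=1..Suc k. r' j / (x + a j))"
    if x: "x \<ge> 0" for x
  proof -
    have step: "r j / (x + a j) * ((x + B) / (x + A)) = (r j - s j) / (x + a j) + s j / (x + A)"
      if j: "j \<in> {1..k}" for j
    proof (cases "a j = A")
      case True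
      then show ?thesis using AB aB[OF j] x by (simp add: s_def)
    next
      case False
      have nz: "x + a j \<noteq> 0" "x + A \<noteq> 0" "A - a j \<noteq> 0"
        using AB aB[OF j] x False by auto
      \<comment> \<open>The residues of \<open>(x + B) / ((x + a j) * (x + A))\<close> at
        \<open>- a j\<close> and \<open>- A\<close> are \<open>(B - a j) / (A - a j)\<close> and
        \<open>(A - B) / (A - a j)\<close>; this is the decomposition with denominators
        cleared.\<close>
      have "(x + B) * (A - a j) = (B - a j) * (x + A) + (A - B) * (x + a j)"
        by (simp add: algebra_simps)
      then have "(x + B) / ((x + a j) * (x + A)) =
          (1 - (A - B) / (A - a j)) / (x + a j) + (A - B) / (A - a j) / (x + A)"
        using nz by (simp add: divide_simps)
      then have "r j * ((x + B) / ((x + a j) * (x + A))) =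
          r j * ((1 - (A - B) / (A - a j)) / (x + a j) + (A - B) / (A - a j) / (x + A))"
        by simp
      then show ?thesis by (simp add: s_def algebra_simps diff_divide_distrib)
    qed
    have "(\<Prod>j=1..Suc k. (x + b j) / (x + a j))
        = (1 - (\<Sum>j=1..k. r j / (x + a j))) * ((x + B) / (x + A))"
      unfolding eq[OF x, symmetric] A_def B_def by simp
    also have "\<dots> = (x + B) / (x + A) - (\<Sum>j=1..k. r j / (x + a j) * ((x + B) / (x + A)))"
      unfolding left_diff_distrib sum_distrib_right mult_1_left ..
    also have "(\<Sum>j=1..k. r j / (x + a j) * ((x + B) / (x + A)))
        = (\<Sum>j=1..k. (r j - s j) / (x + a j)) + (\<Sum>j=1..k. s j) / (x + A)"
      unfolding sum_divide_distrib sum.distrib[symmetric] by (intro sum.cong refl step)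
    also have "(x + B) / (x + A) = 1 - (A - B) / (x + A)"
      using AB x by (simp add: divide_simps)
    also have "(\<Sum>j=1..k. (r j - s j) / (x + a j)) = (\<Sum>j=1..k. r' j / (x + a j))"
      by (intro sum.cong) (auto simp: r'_def)
    finally show ?thesis
      by (simp add: r'_def A_def add_divide_distrib)
  qed
  ultimately show ?case by blast
qed (auto intro: exI[of _ "\<lambda>_. 0"])

text \<open>The constant term of the partial fractions cancels in the increment, and the minus sign
  turns each \<open>1 / (x + a j)\<close> into its \<open>mdiff\<close>. What remains is a
  nonnegative combination of minimal sequences.\<close>

lemma minimal_diff_quotient:
  fixes a b :: "nat \<Rightarrow> real"
  assumes a: "\<And>j. j \<le> k \<Longrightarrow> a j > 0" and b: "\<And>j. j \<le> k \<Longrightarrow> b j > 0"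
    and A1: "\<And>j. 1 \<le> j \<Longrightarrow> j \<le> k \<Longrightarrow> b j \<le> a j"
            "\<And>j. 1 \<le> j \<Longrightarrow> j < k \<Longrightarrow> a j \<le> b (j + 1)"
  defines "q \<equiv> \<lambda>m. root_poly k b (real m) / root_poly k a (real m)"
  shows "minimal_completely_monotone (\<lambda>m. q (Suc m) - q m)"
proof -
  have chain: "a i \<le> b j" if "1 \<le> i" "i < j" "j \<le> k" for i j
  proof -
    have "Suc i \<le> j" using that by simp
    then show ?thesis using that(3)
    proof (induction j rule: dec_induct)
      case base
      then show ?case using A1(2)[of i] that(1) by simp
    next
      case (step n)
      then show ?case using A1(1)[of n] A1(2)[of n] that(1) by force
    qed
  qed
  obtain r where r: "\<And>j. r j \<ge> 0"
    and eq: "\<And>x. x \<ge> 0 \<Longrightarrow> (\<Prod>j=1..k. (x + b j) / (x + a j)) = 1 - (\<Sum>j=1..k. r j / (x + a j))"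
    using interlacing_partial_fractions[of k a b] a A1(1) chain by auto
  have q: "q m = b 0 / a 0 * (1 - (\<Sum>j=1..k. r j / (real m + a j)))" for m
    unfolding q_def root_poly_def eq[OF of_nat_0_le_iff, symmetric] prod_dividef by simp
  have "(\<lambda>m. q (Suc m) - q m)
      = (\<lambda>m. b 0 / a 0 * (\<Sum>j=1..k. r j * mdiff (\<lambda>m. 1 / (a j + real m)) m))"
  proof
    fix m
    show "q (Suc m) - q m = b 0 / a 0 * (\<Sum>j=1..k. r j * mdiff (\<lambda>m. 1 / (a j + real m)) m)"
      unfolding q right_diff_distrib[symmetric]
      by (simp add: mdiff_def sum_subtractf right_diff_distrib add.commute)
  qed
  moreover have "minimal_completely_monotone
      (\<lambda>m. b 0 / a 0 * (\<Sum>j=1..k. r j * mdiff (\<lambda>m. 1 / (a j + real m)) m))"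
    by (intro minimal_cmult minimal_sum minimal_mdiff minimal_inverse_linear r)
       (use a b in \<open>auto simp: less_imp_le\<close>)
  ultimately show ?thesis by simp
qed

section \<open>Mixed differences of the net\<close>

lemma fwd_diff1_funpow: "(fwd_diff1 ^^ i) u m n = (fwd_diff ^^ i) (\<lambda>m. u m n) m"
  by (induction i arbitrary: m) (auto simp: fwd_diff1_def fwd_diff_def)

lemma fwd_diff2_funpow_inverse:
  assumes q: "\<And>m. q m > 0"
  shows "(fwd_diff2 ^^ j) (\<lambda>m n. w m * (1 / (q m + real n))) m n
       = (-1) ^ j * (fact j * w m * (\<Prod>i\<le>j. 1 / (q m + real (n + i))))"
proof (induction j arbitrary: n)
  case (Suc j)
  \<comment> \<open>\<open>P\<close> collects the factors common to the products starting at
    \<open>n\<close> and at \<open>n + 1\<close>. They differ only in the end factors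
    \<open>1 / x\<close> and \<open>1 / y\<close>, and the gap \<open>y - x = j + 1\<close> turns
    \<open>fact j\<close> into \<open>fact (Suc j)\<close>.\<close>
  define P where "P = (\<Prod>i<j. 1 / (q m + real (Suc n + i)))"
  define x where "x = q m + real n"
  define y where "y = q m + real (Suc n + j)"
  have xy: "x > 0" "y > 0" "y - x = real (Suc j)"
    using q[of m] by (auto simp: x_def y_def add_pos_nonneg)
  have up: "(\<Prod>i\<le>j. 1 / (q m + real (Suc n + i))) = P / y"
    by (simp add: P_def y_def flip: lessThan_Suc_atMost)
  have lo: "(\<Prod>i\<le>j. 1 / (q m + real (n + i))) = P / x"
    by (subst lessThan_Suc_atMost[symmetric], subst prod.lessThan_Suc_shift)
       (simp add: P_def x_def)
  have all: "(\<Prod>i\<le>Suc j. 1 / (q m + real (n + i))) = P / (x * y)"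
  proof -
    have "(\<Prod>i\<le>Suc j. 1 / (q m + real (n + i))) = P / x * (1 / (q m + real (n + Suc j)))"
      by (simp only: prod.atMost_Suc lo)
    then show ?thesis by (simp add: y_def)
  qed
  have "P / y - P / x = - (real (Suc j)) * (P / (x * y))"
    using xy(1,2) unfolding xy(3)[symmetric] by (simp add: field_simps)
  moreover have "(-1) ^ j * (fact j * w m) * (- (real (Suc j)) * z)
      = (-1) ^ Suc j * (fact (Suc j) * w m * z)" for z
    by (simp add: algebra_simps)
  ultimately have "(-1) ^ j * (fact j * w m) * (P / y - P / x)
      = (-1) ^ Suc j * (fact (Suc j) * w m * (P / (x * y)))"
    by metis
  moreover have "(fwd_diff2 ^^ Suc j) (\<lambda>m n. w m * (1 / (q m + real n))) m n
      = (-1) ^ j * (fact j * w m) * (P / y - P / x)"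
  proof -
    have "(fwd_diff2 ^^ Suc j) (\<lambda>m n. w m * (1 / (q m + real n))) m n
        = (-1) ^ j * (fact j * w m * (\<Prod>i\<le>j. 1 / (q m + real (Suc n + i))))
        - (-1) ^ j * (fact j * w m * (\<Prod>i\<le>j. 1 / (q m + real (n + i))))"
      unfolding Suc[symmetric] by (simp add: fwd_diff2_def)
    then show ?thesis unfolding up lo by (simp add: right_diff_distrib)
  qed
  ultimately show ?case unfolding all by simp
qed simp

lemma joint_completely_monotone_inverse:
  assumes w: "completely_monotone w" and q: "\<And>m. q m > 0"
    and cm: "completely_monotone (\<lambda>m. q (Suc m) - q m)"
  shows "joint_completely_monotone (\<lambda>m n. w m * (1 / (q m + real n)))"
  unfolding joint_completely_monotone_def
proof (intro allI)
  fix i j m n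
  \<comment> \<open>Up to the sign \<open>(-1) ^ j\<close>, the differences in \<open>n\<close>
    leave \<open>h\<close>. For fixed \<open>n\<close> and \<open>j\<close> it is a product of
    completely monotone sequences in \<open>m\<close>: adding a constant to \<open>q\<close> does
    not change its increments.\<close>
  define h where "h = (\<lambda>m. fact j * w m * (\<Prod>i\<le>j. 1 / (q m + real (n + i))))"
  have h: "completely_monotone h"
    unfolding h_def
    by (intro completely_monotone_mult completely_monotone_prod completely_monotone_inverse
        completely_monotone_const w)
       (use q cm in \<open>auto simp: add_pos_nonneg\<close>)
  have scale: "(fwd_diff ^^ i) (\<lambda>m. r * h m) m = r * (fwd_diff ^^ i) h m" for r
    by (induction i arbitrary: m) (auto simp: fwd_diff_def algebra_simps)
  have "(fwd_diff1 ^^ i) ((fwd_diff2 ^^ j) (\<lambda>m n. w m * (1 / (q m + real n)))) m n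
      = (-1) ^ j * (fwd_diff ^^ i) h m"
    unfolding fwd_diff1_funpow fwd_diff2_funpow_inverse[of q, OF q] h_def
    by (rule scale[unfolded h_def])
  then have "(-1) ^ (i + j) * (fwd_diff1 ^^ i) ((fwd_diff2 ^^ j) (\<lambda>m n. w m * (1 / (q m + real n)))) m n
      = (-1) ^ i * (fwd_diff ^^ i) h m"
    by (simp add: power_add flip: mult.assoc power_mult_distrib)
  then show "(-1) ^ (i + j) * (fwd_diff1 ^^ i) ((fwd_diff2 ^^ j) (\<lambda>m n. w m * (1 / (q m + real n)))) m n \<ge> 0"
    using h by (simp add: completely_monotone_def)
qed

theorem theorem2p1:
  fixes k :: nat and a b c :: "nat \<Rightarrow> real"
  assumes "k \<ge> 1"
    and "\<And>j. j \<le> k \<Longrightarrow> a j > 0"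
    and "\<And>j. j \<le> k \<Longrightarrow> b j > 0"
    and "\<And>m. c m > 0"
    and A1: "\<And>j. 1 \<le> j \<Longrightarrow> j \<le> k \<Longrightarrow> b j \<le> a j"
            "\<And>j. 1 \<le> j \<Longrightarrow> j < k \<Longrightarrow> a j \<le> b (j + 1)"
    and A2: "completely_monotone (\<lambda>m. c m / root_poly k a (real m))"
  shows "joint_completely_monotone
           (\<lambda>m n. c m / (root_poly k b (real m) + root_poly k a (real m) * real n)) \<and>
         (minimal_completely_monotone (\<lambda>m. c m / root_poly k a (real m)) \<longrightarrow>
          minimal_joint_completely_monotone
            (\<lambda>m n. c m / (root_poly k b (real m) + root_poly k a (real m) * real n)))"
proof -
  define w where "w = (\<lambda>m. c m / root_poly k a (real m))"
  define q where "q = (\<lambda>m. root_poly k b (real m) / root_poly k a (real m))"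
  have a_pos: "root_poly k a (real m) > 0" for m
    unfolding root_poly_def using assms(2) by (intro mult_pos_pos prod_pos) (auto simp: add_nonneg_pos)
  have b_pos: "root_poly k b (real m) > 0" for m
    unfolding root_poly_def using assms(3) by (intro mult_pos_pos prod_pos) (auto simp: add_nonneg_pos)
  have q_pos: "q m > 0" for m
    using a_pos b_pos by (simp add: q_def)
  have q_diff: "minimal_completely_monotone (\<lambda>m. q (Suc m) - q m)"
    unfolding q_def by (rule minimal_diff_quotient) (fact assms(2,3) A1)+
  have net: "(\<lambda>m n. c m / (root_poly k b (real m) + root_poly k a (real m) * real n))
      = (\<lambda>m n. w m * (1 / (q m + real n)))"
  proof (intro ext)
    fix m n
    show "c m / (root_poly k b (real m) + root_poly k a (real m) * real n) = w m * (1 / (q m + real n))"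
      using a_pos[of m] by (simp add: w_def q_def divide_simps mult.commute)
  qed
  have joint: "joint_completely_monotone (\<lambda>m n. w m * (1 / (q m + real n)))"
    using A2 q_pos q_diff
    by (intro joint_completely_monotone_inverse)
       (auto simp: w_def minimal_completely_monotone_def)
  have "minimal_joint_completely_monotone (\<lambda>m n. w m * (1 / (q m + real n)))"
    if w: "minimal_completely_monotone w"
  proof -
    \<comment> \<open>The edge \<open>n = 0\<close> is a product of two minimal sequences; the edge
      \<open>m = 0\<close> is a nonnegative multiple of the reciprocal of a linear function.\<close>
    have "minimal_completely_monotone (\<lambda>m. w m * (1 / (q m + real 0)))"
      using q_pos q_diff by (intro minimal_mult w minimal_inverse) auto
    moreover have "minimal_completely_monotone (\<lambda>n. w 0 * (1 / (q 0 + real n)))"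
      using w by (intro minimal_cmult minimal_inverse_linear q_pos)
        (auto simp: minimal_completely_monotone_def completely_monotone_nonneg)
    ultimately show ?thesis
      using joint unfolding minimal_joint_completely_monotone_def minimal_completely_monotone_def
      by blast
  qed
  with joint show ?thesis unfolding net w_def by simp
qed

end
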